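(* Let $p$ be a prime and $b\in(0,\infty)$, and let $(S_n)_{n\in\mathbb N_0}$ be the random walk on $G=\mathbb Q_p/\mathbb Z_p$ defined in the context. There is a $K\in\mathbb R$ such that for any $r\in(0,b)$ and any $n\in\mathbb N$, $$\mathbb E\big[|S_n|^r\big]<K n^{\frac rb}.$$
   Context: $\mathbb N=\{1,2,\dots\}$, $\mathbb N_0=\mathbb N\cup\{0\}$. $|\cdot|$ is the $p$-adic absolute value on $\mathbb Q_p$. $G=\mathbb Q_p/\mathbb Z_p$, $[x]=x+\mathbb Z_p$, and $|[x]|=|x|$ if $[x]\ne[0]$, $|[0]|=0$. $X$ is a $G$-valued random variable with $\mathrm{Prob}(X=[0])=0$ and $\mathrm{Prob}(X=g)=\frac{p^b-1}{p^{ib}}\cdot\frac1{p^i-p^{i-1}}$ if $|g|=p^i$, $i\in\mathbb N$. $X_1,X_2,\dots$ are i.i.d. copies of $X$, $S_0=[0]$ and $S_n=X_1+\dots+X_n$. $\mathbb E$ denotes expected value.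
   Formalization: K may depend on r (but not on n): a single K for all r in (0,b) is impossible, since already for n=1 one has E|S_1|^r = (p^b-1)/(p^(b-r)-1), which tends to infinity as r tends to b. *)

theory Defs
  imports
    "HOL-Probability.Probability"
    "HOL-Algebra.QuotRing"
    "HOL-Computational_Algebra.Primes"
begin

definition padic_abs :: "nat \<Rightarrow> rat \<Rightarrow> real" where
  "padic_abs p q =
    (if q = 0 then 0
     else real p powi (int (multiplicity (int p) (snd (quotient_of q)))
                       - int (multiplicity (int p) (fst (quotient_of q)))))"

text \<open>The field of \<open>p\<close>-adic numbers is the completion of the rationals with respect to
  \<^const>\<open>padic_abs\<close>: the ring of Cauchy sequences modulo the ideal of null sequences.\<close>

definition padic_cauchy_ring :: "nat \<Rightarrow> (nat \<Rightarrow> rat) ring" where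
  "padic_cauchy_ring p =
    \<lparr>carrier = {s. \<forall>e>0. \<exists>N. \<forall>m\<ge>N. \<forall>n\<ge>N. padic_abs p (s m - s n) < e},
     monoid.mult = (\<lambda>s t n. s n * t n),
     one = (\<lambda>n. 1),
     zero = (\<lambda>n. 0),
     add = (\<lambda>s t n. s n + t n)\<rparr>"

definition padic_null_ideal :: "nat \<Rightarrow> (nat \<Rightarrow> rat) set" where
  "padic_null_ideal p =
    {s \<in> carrier (padic_cauchy_ring p). (\<lambda>n. padic_abs p (s n)) \<longlonglongrightarrow> 0}"

type_synonym padic = "(nat \<Rightarrow> rat) set"

definition Qp :: "nat \<Rightarrow> padic ring" where
  "Qp p = padic_cauchy_ring p Quot padic_null_ideal p"

text \<open>An element of \<^const>\<open>Qp\<close> is a coset of Cauchy sequences; the absolute values along any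
  representative converge to the same limit.\<close>

definition padic_norm :: "nat \<Rightarrow> padic \<Rightarrow> real" where
  "padic_norm p x = (THE l. \<forall>s\<in>x. (\<lambda>n. padic_abs p (s n)) \<longlonglongrightarrow> l)"

definition Zp :: "nat \<Rightarrow> padic set" where
  "Zp p = {x \<in> carrier (Qp p). padic_norm p x \<le> 1}"

text \<open>The additive group \<open>\<rat>\<^sub>p / \<int>\<^sub>p\<close>. Following the conventions of \<^theory>\<open>HOL-Algebra.AbelCoset\<close>, its
  addition is written \<open>\<otimes>\<close>, its neutral element is \<open>\<one>\<close>, which is the coset \<^term>\<open>Zp p\<close>, and the
  elements are cosets \<^term>\<open>Zp p +>\<^bsub>Qp p\<^esub> x\<close>.\<close>

definition QpZp :: "nat \<Rightarrow> padic set monoid" where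
  "QpZp p = Qp p A_Mod Zp p"

text \<open>All representatives of a nonzero coset have the same absolute value.\<close>

definition QpZp_norm :: "nat \<Rightarrow> padic set \<Rightarrow> real" where
  "QpZp_norm p g =
    (if g = \<one>\<^bsub>QpZp p\<^esub> then 0 else (THE l. \<forall>x\<in>g. padic_norm p x = l))"

text \<open>The quotient topology on \<^const>\<open>QpZp\<close> is discrete, so random variables are measurable with
  respect to all subsets.\<close>

definition has_step_law :: "nat \<Rightarrow> real \<Rightarrow> 'w measure \<Rightarrow> ('w \<Rightarrow> padic set) \<Rightarrow> bool" where
  "has_step_law p b M Y \<longleftrightarrow>
    Y \<in> measurable M (count_space (carrier (QpZp p))) \<and>
    measure M {\<omega> \<in> space M. Y \<omega> = \<one>\<^bsub>QpZp p\<^esub>} = 0 \<and>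
    (\<forall>i::nat. \<forall>g \<in> carrier (QpZp p). i \<ge> 1 \<longrightarrow> QpZp_norm p g = real p ^ i \<longrightarrow>
       measure M {\<omega> \<in> space M. Y \<omega> = g} =
         (real p powr b - 1) / real p powr (real i * b) * (1 / (real p ^ i - real p ^ (i - 1))))"

text \<open>The summands are \<open>X 1, X 2, \<dots>\<close>; \<open>X 0\<close> is not used.\<close>

primrec random_walk :: "nat \<Rightarrow> (nat \<Rightarrow> 'w \<Rightarrow> padic set) \<Rightarrow> nat \<Rightarrow> 'w \<Rightarrow> padic set" where
  "random_walk p X 0 \<omega> = \<one>\<^bsub>QpZp p\<^esub>"
| "random_walk p X (Suc n) \<omega> = random_walk p X n \<omega> \<otimes>\<^bsub>QpZp p\<^esub> X (Suc n) \<omega>"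

end

theory Submission
  imports Defs "HOL-Number_Theory.Cong"
begin

text \<open>Since the rationals are dense in \<open>\<rat>\<^sub>p\<close> and \<open>\<int>\<^sub>p\<close> is a neighbourhood of \<open>0\<close>, every element of
  \<open>\<rat>\<^sub>p / \<int>\<^sub>p\<close> is the coset of a rational. This gives the ultrametric inequality on the quotient and
  at most \<open>p ^ i\<close> elements of absolute value \<open>p ^ i\<close>, hence a step has absolute value \<open>p ^ i\<close> with
  probability \<open>O(p powr (- i * b))\<close>. For every threshold \<open>T\<close> the ultrametric inequality bounds
  \<open>|S\<^sub>n| powr r\<close> by \<open>T powr r\<close> plus the sum over the steps of \<open>|X\<^sub>k| powr r\<close> restricted to
  \<open>|X\<^sub>k| > T\<close>. A geometric series bounds the expectation of each such term by a multiple of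
  \<open>T powr (r - b)\<close>, and \<open>T = n powr (1 / b)\<close> balances the two contributions.\<close>

section \<open>The absolute value on the rationals\<close>

locale padic_prime =
  fixes p :: nat
  assumes prime_p: "prime p"
begin

lemma p_gt_1: "real p > 1"
  using prime_gt_1_nat[OF prime_p] by simp

text \<open>\<open>padic_abs\<close> is defined through the reduced fraction. Cross-multiplying two
  fractions for the same rational, together with additivity of the multiplicity of a prime, shows
  that every fraction gives the same exponent, so later computations can use unreduced ones.\<close>

lemma padic_abs_divide_of_int:
  assumes "a \<noteq> 0" "b \<noteq> 0"
  shows "padic_abs p (of_int a / of_int b) =
    real p powi (int (multiplicity (int p) b) - int (multiplicity (int p) a))"
proof -
  obtain c d where cd: "quotient_of (of_int a / of_int b) = (c, d)"
    by fastforce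
  have d: "d > 0"
    using quotient_of_denom_pos[OF cd] .
  have eq: "(of_int a / of_int b :: rat) = of_int c / of_int d"
    using quotient_of_div[OF cd] .
  then have c: "c \<noteq> 0"
    using assms by auto
  have "(of_int (a * d) :: rat) = of_int (c * b)"
    using eq d assms by (simp add: field_simps)
  then have "a * d = c * b"
    by (simp only: of_int_eq_iff)
  then have "multiplicity (int p) a + multiplicity (int p) d =
      multiplicity (int p) c + multiplicity (int p) b"
    using prime_p assms c d prime_elem_multiplicity_mult_distrib[of "int p" a d]
      prime_elem_multiplicity_mult_distrib[of "int p" c b] by simp
  then have "int (multiplicity (int p) d) - int (multiplicity (int p) c) =
      int (multiplicity (int p) b) - int (multiplicity (int p) a)"
    by linarith
  then show ?thesis
    using assms unfolding padic_abs_def cd by simp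
qed

lemma padic_abs_0 [simp]: "padic_abs p 0 = 0"
  by (simp add: padic_abs_def)

lemma padic_abs_pos: "x \<noteq> 0 \<Longrightarrow> padic_abs p x > 0"
  using p_gt_1 by (simp add: padic_abs_def zero_less_power_int)

lemma padic_abs_nonneg [simp]: "padic_abs p x \<ge> 0"
  using padic_abs_pos[of x] by (cases "x = 0") auto

lemma padic_abs_mult: "padic_abs p (x * y) = padic_abs p x * padic_abs p y"
proof (cases "x = 0 \<or> y = 0")
  case False
  obtain a b where x: "x = of_int a / of_int b" and "b \<noteq> 0"
    by (metis less_irrefl quotient_of_denom_pos' quotient_of_div surjective_pairing)
  obtain c d where y: "y = of_int c / of_int d" and "d \<noteq> 0"
    by (metis less_irrefl quotient_of_denom_pos' quotient_of_div surjective_pairing)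
  have nz: "a \<noteq> 0" "b \<noteq> 0" "c \<noteq> 0" "d \<noteq> 0"
    using False x y \<open>b \<noteq> 0\<close> \<open>d \<noteq> 0\<close> by auto
  have "x * y = of_int (a * c) / of_int (b * d)"
    by (simp add: x y)
  then have "padic_abs p (x * y) =
      real p powi (int (multiplicity (int p) (b * d)) - int (multiplicity (int p) (a * c)))"
    using padic_abs_divide_of_int[of "a * c" "b * d"] nz by simp
  also have "\<dots> = real p powi (int (multiplicity (int p) b) - int (multiplicity (int p) a) +
      (int (multiplicity (int p) d) - int (multiplicity (int p) c)))"
    using nz prime_p by (simp add: prime_elem_multiplicity_mult_distrib algebra_simps)
  also have "\<dots> = padic_abs p x * padic_abs p y"
    using nz p_gt_1 unfolding x y
    by (subst power_int_add) (simp_all add: padic_abs_divide_of_int)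
  finally show ?thesis .
qed auto

lemma padic_abs_uminus [simp]: "padic_abs p (- x) = padic_abs p x"
proof -
  have "padic_abs p (- 1) = 1"
    using padic_abs_divide_of_int[of "- 1" 1] by (simp add: multiplicity_unit_right)
  then show ?thesis
    using padic_abs_mult[of "- 1" x] by simp
qed

lemma padic_abs_of_int_le_1: "padic_abs p (of_int a) \<le> 1"
proof (cases "a = 0")
  case False
  then show ?thesis
    using padic_abs_divide_of_int[of a 1] p_gt_1
    by (simp add: power_int_minus inverse_le_1_iff)
qed auto

text \<open>The reduced fraction works: if \<open>p\<close> divided its denominator, it would not
  divide the numerator, and the absolute value would exceed 1. The unit ball of the rationals is
  thus the localization of the integers at \<open>p\<close>.\<close>

lemma padic_abs_le_1E:
  assumes "padic_abs p x \<le> 1"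
  obtains a b where "x = of_int a / of_int b" "\<not> int p dvd b"
proof (cases "x = 0")
  case True
  then show ?thesis
    using that[of 0 1] prime_p by (metis of_int_0 div_0 not_prime_1 int_ops(2) zdvd1_eq abs_of_nat of_nat_eq_iff)
next
  case False
  obtain a b where ab: "quotient_of x = (a, b)"
    by fastforce
  have x: "x = of_int a / of_int b" and b: "b > 0" and cop: "coprime a b"
    using quotient_of_div[OF ab] quotient_of_denom_pos[OF ab] quotient_of_coprime[OF ab] .
  have "\<not> int p dvd b"
  proof
    assume dvd: "int p dvd b"
    have a: "a \<noteq> 0"
      using False x by auto
    have pr: "prime (int p)"
      using prime_p by simp
    have "\<not> int p dvd a"
      using dvd cop pr coprime_common_divisor not_prime_unit by blast
    then have "multiplicity (int p) a = 0"
      by (rule not_dvd_imp_multiplicity_0)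
    moreover have "multiplicity (int p) b > 0"
      using dvd pr b by (simp add: prime_multiplicity_gt_zero_iff)
    ultimately have "padic_abs p x > 1"
      unfolding x using a b p_gt_1 by (simp add: padic_abs_divide_of_int one_less_power)
    with assms show False
      by simp
  qed
  with x that show ?thesis
    by blast
qed

lemma padic_abs_of_int_eq_1: "\<not> int p dvd b \<Longrightarrow> padic_abs p (of_int b) = 1"
  using padic_abs_divide_of_int[of b 1] not_dvd_imp_multiplicity_0[of "int p" b] by fastforce

lemma padic_abs_divide: "padic_abs p (x / y) = padic_abs p x / padic_abs p y"
proof (cases "y = 0")
  case False
  then show ?thesis
    using padic_abs_mult[of "x / y" y] padic_abs_pos[of y] by (simp add: field_simps)
qed auto

text \<open>Dividing by the larger argument reduces the claim to showing that adding 1 does not lead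
  out of the unit ball. This is visible on a fraction whose denominator is prime to
  \<open>p\<close>.\<close>

lemma padic_abs_add: "padic_abs p (x + y) \<le> max (padic_abs p x) (padic_abs p y)"
proof -
  have *: "padic_abs p (x + y) \<le> padic_abs p y" if "padic_abs p x \<le> padic_abs p y" for x y
  proof (cases "y = 0")
    case True
    then show ?thesis
      using that padic_abs_pos[of x] by force
  next
    case False
    have "padic_abs p (x / y) \<le> 1"
      using that padic_abs_pos[OF False] by (simp add: padic_abs_divide)
    then obtain a b where ab: "x / y = of_int a / of_int b" "\<not> int p dvd b"
      by (rule padic_abs_le_1E)
    have "b \<noteq> 0"
      using ab by auto
    then have "x / y + 1 = of_int (a + b) / of_int b"
      using ab by (simp add: field_simps)
    then have "padic_abs p (x / y + 1) \<le> 1"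
      using padic_abs_of_int_le_1[of "a + b"] ab
      by (simp add: padic_abs_divide padic_abs_of_int_eq_1 del: of_int_add)
    moreover have "x + y = (x / y + 1) * y"
      using False by (simp add: field_simps)
    ultimately show ?thesis
      using padic_abs_pos[OF False] by (simp add: padic_abs_mult)
  qed
  show ?thesis
    using *[of x y] *[of y x] by (cases "padic_abs p x \<le> padic_abs p y") (auto simp: add.commute)
qed

lemma padic_abs_diff_commute: "padic_abs p (x - y) = padic_abs p (y - x)"
  by (metis minus_diff_eq padic_abs_uminus)

text \<open>Serves to carry Cauchy and null sequences of rationals over to the real sequences of
  their absolute values.\<close>

lemma abs_padic_abs_diff_le: "\<bar>padic_abs p x - padic_abs p y\<bar> \<le> padic_abs p (x - y)"
proof -
  have "padic_abs p x \<le> padic_abs p (x - y) + padic_abs p y" for x y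
    using padic_abs_add[of "x - y" y] padic_abs_nonneg[of "x - y"] padic_abs_nonneg[of y] by (simp del: padic_abs_nonneg)
  from this[of x y] this[of y x] show ?thesis
    by (simp add: padic_abs_diff_commute)
qed

section \<open>Values and principal parts of rationals\<close>

lemma padic_abs_gt_1E:
  assumes "padic_abs p x > 1"
  obtains i where "i \<ge> 1" "padic_abs p x = real p ^ i"
proof -
  have "x \<noteq> 0"
    using assms by auto
  then obtain k :: int where k: "padic_abs p x = real p powi k"
    by (auto simp: padic_abs_def)
  have "k > 0"
  proof (rule ccontr)
    assume "\<not> k > 0"
    then have "real p powi k \<le> real p powi 0"
      using p_gt_1 by (intro power_int_increasing) auto
    with assms k show False
      by simp
  qed
  then show ?thesis
    using that[of "nat k"] k by (simp add: power_int_def)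
qed

text \<open>Multiplying by \<open>p ^ i\<close> leaves a fraction \<open>u / v\<close> with
  \<open>v\<close> invertible modulo \<open>p ^ i\<close>. Subtracting its residue \<open>a\<close>
  makes the numerator divisible by \<open>p ^ i\<close>, and dividing back gives a rational with
  denominator \<open>v\<close>. This is what bounds the number of cosets of given norm.\<close>

lemma padic_principal_part:
  assumes "padic_abs p x \<le> real p ^ i"
  obtains a where "a < p ^ i" "padic_abs p (x - of_nat a / of_nat p ^ i) \<le> 1"
proof -
  have p0: "p > 0"
    using prime_p prime_gt_0_nat by blast
  have abs_pow: "padic_abs p (of_nat p ^ i) = inverse (real p ^ i)"
    using padic_abs_divide_of_int[of "int p ^ i" 1] prime_p p0
    by (simp add: power_int_minus)
  have "padic_abs p (x * of_nat p ^ i) \<le> 1"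
    using assms p0 by (simp add: padic_abs_mult abs_pow field_simps)
  then obtain u v where uv: "x * of_nat p ^ i = of_int u / of_int v" "\<not> int p dvd v"
    by (rule padic_abs_le_1E)
  have "coprime v (int p ^ i)"
    using uv(2) prime_p prime_imp_coprime[of "int p" v] by (simp add: coprime_commute)
  then obtain w where w: "[v * w = 1] (mod int p ^ i)"
    using cong_solve_coprime_int by blast
  \<comment> \<open>The residue of \<open>u / v\<close> modulo \<open>p ^ i\<close>, where
    \<open>w\<close> inverts \<open>v\<close>.\<close>
  define a where "a = nat ((u * w) mod (int p ^ i))"
  have pi: "int p ^ i > 0"
    using p0 by simp
  have a: "int a = (u * w) mod (int p ^ i)"
    using pi by (simp add: a_def)
  have "int a < int p ^ i"
    using pi by (simp add: a)
  then have "a < p ^ i"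
    by (metis of_nat_less_iff of_nat_power)
  have "[v * int a = u] (mod int p ^ i)"
  proof -
    have "[v * int a = v * (u * w)] (mod int p ^ i)"
      by (simp add: a cong_def mod_mult_right_eq)
    also have "[v * (u * w) = u * (v * w)] (mod int p ^ i)"
      by (simp add: ac_simps)
    also have "[u * (v * w) = u * 1] (mod int p ^ i)"
      using w by (rule cong_scalar_left)
    finally show ?thesis
      by simp
  qed
  then have "int p ^ i dvd u - v * int a"
    by (simp add: cong_iff_dvd_diff dvd_diff_commute)
  then obtain c where c: "u - v * int a = int p ^ i * c"
    by (auto elim: dvdE)
  have v0: "v \<noteq> 0"
    using uv by auto
  have "(of_int (u - v * int a) :: rat) = of_nat p ^ i * of_int c"
    unfolding c by simp
  then have "x - of_nat a / of_nat p ^ i = of_int c / of_int v"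
    using uv(1) v0 p0 by (simp add: field_simps)
  then have "padic_abs p (x - of_nat a / of_nat p ^ i) \<le> 1"
    using padic_abs_of_int_le_1[of c] uv(2) by (simp add: padic_abs_divide padic_abs_of_int_eq_1)
  with \<open>a < p ^ i\<close> that show ?thesis
    by blast
qed

section \<open>The quotient group\<close>

abbreviation Cauchy_ring :: "(nat \<Rightarrow> rat) ring" where
  "Cauchy_ring \<equiv> padic_cauchy_ring p"

abbreviation cls :: "(nat \<Rightarrow> rat) \<Rightarrow> padic" where
  "cls s \<equiv> padic_null_ideal p +>\<^bsub>Cauchy_ring\<^esub> s"

text \<open>Expresses that \<open>l\<close> is the value which \<open>THE\<close> in
  \<open>padic_norm\<close> has to pick for the class of \<open>s\<close>.\<close>

abbreviation lift_norm :: "(nat \<Rightarrow> rat) \<Rightarrow> real \<Rightarrow> bool" where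
  "lift_norm s l \<equiv> (\<lambda>n. padic_abs p (s n)) \<longlonglongrightarrow> l"

section \<open>The additive group of Cauchy sequences and its null sequences\<close>

lemma Cauchy_ring_simps [simp]:
  "add Cauchy_ring s t = (\<lambda>n. s n + t n)" "zero Cauchy_ring = (\<lambda>n. 0)"
  by (simp_all add: padic_cauchy_ring_def)

lemma Cauchy_ring_carrier_iff:
  "s \<in> carrier Cauchy_ring \<longleftrightarrow> (\<forall>e>0. \<exists>N. \<forall>m\<ge>N. \<forall>n\<ge>N. padic_abs p (s m - s n) < e)"
  by (simp add: padic_cauchy_ring_def)

lemma const_in_Cauchy_ring [simp]: "(\<lambda>n. q) \<in> carrier Cauchy_ring"
  by (simp add: Cauchy_ring_carrier_iff)

lemma add_in_Cauchy_ring: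
  assumes "s \<in> carrier Cauchy_ring" "t \<in> carrier Cauchy_ring"
  shows "(\<lambda>n. s n + t n) \<in> carrier Cauchy_ring"
  unfolding Cauchy_ring_carrier_iff
proof (intro allI impI)
  fix e :: real
  assume "e > 0"
  obtain M where M: "\<forall>m\<ge>M. \<forall>n\<ge>M. padic_abs p (s m - s n) < e"
    using assms(1) \<open>e > 0\<close> unfolding Cauchy_ring_carrier_iff by presburger
  obtain N where N: "\<forall>m\<ge>N. \<forall>n\<ge>N. padic_abs p (t m - t n) < e"
    using assms(2) \<open>e > 0\<close> unfolding Cauchy_ring_carrier_iff by presburger
  have "padic_abs p (s m + t m - (s n + t n)) < e" if "m \<ge> max M N" "n \<ge> max M N" for m n
  proof -
    have "padic_abs p (s m - s n) < e" "padic_abs p (t m - t n) < e"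
      using that M N by auto
    then show ?thesis
      using padic_abs_add[of "s m - s n" "t m - t n"] by (simp add: algebra_simps)
  qed
  then show "\<exists>N. \<forall>m\<ge>N. \<forall>n\<ge>N. padic_abs p (s m + t m - (s n + t n)) < e"
    by blast
qed

lemma uminus_in_Cauchy_ring:
  assumes "s \<in> carrier Cauchy_ring"
  shows "(\<lambda>n. - s n) \<in> carrier Cauchy_ring"
  using assms unfolding Cauchy_ring_carrier_iff
  by (simp add: padic_abs_diff_commute)

lemma abelian_group_Cauchy_ring: "abelian_group Cauchy_ring"
proof (rule abelian_groupI)
  fix s
  assume "s \<in> carrier Cauchy_ring"
  then show "\<exists>t\<in>carrier Cauchy_ring. t \<oplus>\<^bsub>Cauchy_ring\<^esub> s = \<zero>\<^bsub>Cauchy_ring\<^esub>"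
    by (intro bexI[of _ "\<lambda>n. - s n"]) (simp_all add: uminus_in_Cauchy_ring)
qed (auto simp: add_in_Cauchy_ring algebra_simps)

lemma Cauchy_ring_a_inv:
  assumes "s \<in> carrier Cauchy_ring"
  shows "\<ominus>\<^bsub>Cauchy_ring\<^esub> s = (\<lambda>n. - s n)"
proof -
  interpret abelian_group Cauchy_ring
    by (rule abelian_group_Cauchy_ring)
  show ?thesis
    using assms uminus_in_Cauchy_ring by (intro add.inv_equality) auto
qed

text \<open>By the reverse triangle inequality the absolute values along \<open>s\<close> form a
  Cauchy sequence of reals.\<close>

lemma lift_norm_exists:
  assumes "s \<in> carrier Cauchy_ring"
  obtains l where "lift_norm s l"
proof -
  have "Cauchy (\<lambda>n. padic_abs p (s n))"
    unfolding Cauchy_def dist_real_def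
  proof (intro allI impI)
    fix e :: real
    assume "e > 0"
    then obtain N where N: "\<forall>m\<ge>N. \<forall>n\<ge>N. padic_abs p (s m - s n) < e"
      using assms unfolding Cauchy_ring_carrier_iff by presburger
    show "\<exists>N. \<forall>m\<ge>N. \<forall>n\<ge>N. \<bar>padic_abs p (s m) - padic_abs p (s n)\<bar> < e"
      using N by (intro exI[of _ N]) (auto intro: order_le_less_trans[OF abs_padic_abs_diff_le])
  qed
  then show ?thesis
    using that Cauchy_convergent convergent_def by blast
qed

lemma null_ideal_additive_subgroup: "additive_subgroup (padic_null_ideal p) Cauchy_ring"
proof (rule additive_subgroupI)
  interpret abelian_group Cauchy_ring
    by (rule abelian_group_Cauchy_ring)
  show "subgroup (padic_null_ideal p) (add_monoid Cauchy_ring)"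
  proof (rule add.subgroupI)
    fix s
    assume "s \<in> padic_null_ideal p"
    then show "\<ominus>\<^bsub>Cauchy_ring\<^esub> s \<in> padic_null_ideal p"
      by (simp add: padic_null_ideal_def Cauchy_ring_a_inv uminus_in_Cauchy_ring)
  next
    fix s t
    assume st: "s \<in> padic_null_ideal p" "t \<in> padic_null_ideal p"
    have "(\<lambda>n. padic_abs p (s n + t n)) \<longlonglongrightarrow> 0"
    proof (rule real_tendsto_sandwich[where f = "\<lambda>n. 0"])
      show "(\<lambda>n. max (padic_abs p (s n)) (padic_abs p (t n))) \<longlonglongrightarrow> 0"
        using tendsto_max[of "\<lambda>n. padic_abs p (s n)" 0 sequentially "\<lambda>n. padic_abs p (t n)" 0] st
        by (simp add: padic_null_ideal_def)
    qed (simp_all add: padic_abs_add)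
    then show "s \<oplus>\<^bsub>Cauchy_ring\<^esub> t \<in> padic_null_ideal p"
      using st by (simp add: padic_null_ideal_def add_in_Cauchy_ring)
  next
    have "(\<lambda>n. 0) \<in> padic_null_ideal p"
      by (simp add: padic_null_ideal_def)
    then show "padic_null_ideal p \<noteq> {}"
      by blast
    show "padic_null_ideal p \<subseteq> carrier Cauchy_ring"
      by (auto simp only: padic_null_ideal_def)
  qed
qed

lemma null_ideal_abelian_subgroup: "abelian_subgroup (padic_null_ideal p) Cauchy_ring"
  by (intro abelian_subgroupI3 null_ideal_additive_subgroup abelian_group_Cauchy_ring)

section \<open>Addition and norm on the completion\<close>

lemma Qp_simps:
  "add (Qp p) = set_add Cauchy_ring" "zero (Qp p) = padic_null_ideal p"
  "carrier (Qp p) = cls ` carrier Cauchy_ring"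
  unfolding Qp_def FactRing_def by (auto simp: A_RCOSETS_def' a_r_coset_def')

text \<open>The quotient ring and the factor group by the null sequences have the same addition, so
  commutativity of the factor group carries over.\<close>

lemma abelian_group_Qp: "abelian_group (Qp p)"
proof (rule comm_group_abelian_groupI)
  interpret abelian_subgroup "padic_null_ideal p" Cauchy_ring
    by (rule null_ideal_abelian_subgroup)
  show "comm_group (add_monoid (Qp p))"
    using a_factorgroup_is_comm_group by (simp add: Qp_def FactRing_def A_FactGroup_def')
qed

lemma cls_in_Qp [simp]: "s \<in> carrier Cauchy_ring \<Longrightarrow> cls s \<in> carrier (Qp p)"
  by (simp add: Qp_simps)

lemma Qp_add_cls:
  assumes "s \<in> carrier Cauchy_ring" "t \<in> carrier Cauchy_ring"
  shows "cls s \<oplus>\<^bsub>Qp p\<^esub> cls t = cls (\<lambda>n. s n + t n)"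
proof -
  interpret abelian_subgroup "padic_null_ideal p" Cauchy_ring
    by (rule null_ideal_abelian_subgroup)
  show ?thesis
    using a_rcos_sum[OF assms] by (simp add: Qp_simps)
qed

lemma cls_zero: "cls (\<lambda>n. 0) = \<zero>\<^bsub>Qp p\<^esub>"
proof -
  interpret abelian_subgroup "padic_null_ideal p" Cauchy_ring
    by (rule null_ideal_abelian_subgroup)
  have zero_closed: "(\<lambda>n. 0) \<in> padic_null_ideal p"
    unfolding padic_null_ideal_def by simp
  show ?thesis
    using a_rcos_const[OF zero_closed] by (simp add: Qp_simps)
qed

lemma Qp_uminus_cls:
  assumes "s \<in> carrier Cauchy_ring"
  shows "\<ominus>\<^bsub>Qp p\<^esub> cls s = cls (\<lambda>n. - s n)"
proof -
  interpret abelian_group "Qp p"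
    by (rule abelian_group_Qp)
  show ?thesis
    using assms uminus_in_Cauchy_ring
    by (intro add.inv_equality) (simp_all add: Qp_add_cls cls_zero)
qed

text \<open>Members of the class differ from \<open>s\<close> by a null sequence, so their absolute
  values have the same limit. As \<open>s\<close> lies in its own class, no other limit is possible,
  and \<open>THE\<close> is determined.\<close>

lemma padic_norm_cls:
  assumes s: "s \<in> carrier Cauchy_ring" and l: "lift_norm s l"
  shows "padic_norm p (cls s) = l"
  unfolding padic_norm_def
proof (rule the_equality)
  interpret abelian_subgroup "padic_null_ideal p" Cauchy_ring
    by (rule null_ideal_abelian_subgroup)
  show "\<forall>t\<in>cls s. lift_norm t l"
  proof
    fix t
    assume "t \<in> cls s"
    then obtain u where u: "u \<in> padic_null_ideal p" and t: "t = (\<lambda>n. u n + s n)"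
      unfolding a_r_coset_def' Cauchy_ring_simps by blast
    have "(\<lambda>n. padic_abs p (t n) - padic_abs p (s n)) \<longlonglongrightarrow> 0"
    proof (rule Lim_null_comparison)
      show "(\<lambda>n. padic_abs p (u n)) \<longlonglongrightarrow> 0"
        using u unfolding padic_null_ideal_def by blast
      show "\<forall>\<^sub>F n in sequentially. norm (padic_abs p (t n) - padic_abs p (s n)) \<le> padic_abs p (u n)"
      proof (rule always_eventually, rule allI)
        fix n
        show "norm (padic_abs p (t n) - padic_abs p (s n)) \<le> padic_abs p (u n)"
          using abs_padic_abs_diff_le[of "u n + s n" "s n"] unfolding t by simp
      qed
    qed
    from tendsto_add[OF this l] show "lift_norm t l"
      by simp
  qed
  fix l'
  assume "\<forall>t\<in>cls s. lift_norm t l'"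
  with a_rcos_self[OF s] have "lift_norm s l'"
    by blast
  with l show "l' = l"
    using LIMSEQ_unique by blast
qed

lemma padic_norm_const [simp]: "padic_norm p (cls (\<lambda>n. q)) = padic_abs p q"
  by (rule padic_norm_cls) auto

text \<open>The ultrametric inequality holds termwise along representatives and survives the
  limit.\<close>

lemma padic_norm_add:
  assumes "x \<in> carrier (Qp p)" "y \<in> carrier (Qp p)"
  shows "padic_norm p (x \<oplus>\<^bsub>Qp p\<^esub> y) \<le> max (padic_norm p x) (padic_norm p y)"
proof -
  obtain s t where s: "s \<in> carrier Cauchy_ring" "x = cls s"
    and t: "t \<in> carrier Cauchy_ring" "y = cls t"
    using assms by (auto simp: Qp_simps)
  obtain l k m where lims: "lift_norm s l" "lift_norm t k" "lift_norm (\<lambda>n. s n + t n) m"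
    using lift_norm_exists s t add_in_Cauchy_ring by metis
  have "m \<le> max l k"
    using lims(3) tendsto_max[OF lims(1,2)] by (rule LIMSEQ_le) (simp add: padic_abs_add)
  then show ?thesis
    using lims s t by (simp add: Qp_add_cls padic_norm_cls add_in_Cauchy_ring)
qed

lemma padic_norm_uminus:
  assumes "x \<in> carrier (Qp p)"
  shows "padic_norm p (\<ominus>\<^bsub>Qp p\<^esub> x) = padic_norm p x"
proof -
  obtain s where s: "s \<in> carrier Cauchy_ring" "x = cls s"
    using assms by (auto simp: Qp_simps)
  obtain l where l: "lift_norm s l"
    using lift_norm_exists s by metis
  then show ?thesis
    using s by (simp add: Qp_uminus_cls padic_norm_cls uminus_in_Cauchy_ring)
qed

section \<open>The quotient by the unit ball, through rational representatives\<close>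

lemma Zp_additive_subgroup: "additive_subgroup (Zp p) (Qp p)"
proof (rule additive_subgroupI)
  interpret abelian_group "Qp p"
    by (rule abelian_group_Qp)
  have zero: "\<zero>\<^bsub>Qp p\<^esub> \<in> Zp p"
    unfolding Zp_def cls_zero[symmetric] by simp
  show "subgroup (Zp p) (add_monoid (Qp p))"
  proof (rule add.subgroupI)
    fix x y
    assume "x \<in> Zp p" "y \<in> Zp p"
    then show "x \<oplus>\<^bsub>Qp p\<^esub> y \<in> Zp p"
      using padic_norm_add[of x y] by (auto simp: Zp_def)
  qed (use zero in \<open>auto simp: Zp_def padic_norm_uminus\<close>)
qed

lemma Zp_abelian_subgroup: "abelian_subgroup (Zp p) (Qp p)"
  by (intro abelian_subgroupI3 Zp_additive_subgroup abelian_group_Qp)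

text \<open>The class \<open>[q]\<close> of a rational, embedded as a constant sequence. These
  classes exhaust the quotient, so computations there reduce to rationals.\<close>

definition rat_coset :: "rat \<Rightarrow> padic set" where
  "rat_coset q = Zp p +>\<^bsub>Qp p\<^esub> cls (\<lambda>n. q)"

lemma QpZp_simps:
  "carrier (QpZp p) = a_rcosets\<^bsub>Qp p\<^esub> Zp p" "\<one>\<^bsub>QpZp p\<^esub> = Zp p"
  "x \<otimes>\<^bsub>QpZp p\<^esub> y = x <+>\<^bsub>Qp p\<^esub> y"
  by (simp_all add: QpZp_def A_FactGroup_def' set_add_def')

lemma comm_group_QpZp: "comm_group (QpZp p)"
  unfolding QpZp_def by (rule abelian_subgroup.a_factorgroup_is_comm_group[OF Zp_abelian_subgroup])

lemma mem_rat_coset_iff: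
  assumes "s \<in> carrier Cauchy_ring"
  shows "cls s \<in> rat_coset q \<longleftrightarrow> padic_norm p (cls (\<lambda>n. s n - q)) \<le> 1"
proof -
  have Zp_iff: "cls s \<in> Zp p \<longleftrightarrow> padic_norm p (cls s) \<le> 1" if "s \<in> carrier Cauchy_ring" for s
    using that by (simp add: Zp_def)
  interpret abelian_subgroup "Zp p" "Qp p"
    by (rule Zp_abelian_subgroup)
  have "(\<lambda>n. s n - q) \<in> carrier Cauchy_ring"
    using add_in_Cauchy_ring[OF assms const_in_Cauchy_ring[of "- q"]] by simp
  then show ?thesis
    using assms unfolding rat_coset_def
    by (subst a_rcos_module) (simp_all add: Zp_iff Qp_uminus_cls Qp_add_cls)
qed

lemma rat_coset_eqI:
  assumes "padic_abs p (q - q') \<le> 1"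
  shows "rat_coset q = rat_coset q'"
proof -
  interpret abelian_subgroup "Zp p" "Qp p"
    by (rule Zp_abelian_subgroup)
  have "cls (\<lambda>n. q) \<in> rat_coset q'"
    using assms by (simp add: mem_rat_coset_iff)
  then show ?thesis
    using a_repr_independence'[of "cls (\<lambda>n. q)" "cls (\<lambda>n. q')"] by (simp add: rat_coset_def)
qed

text \<open>A Cauchy sequence \<open>s\<close> eventually stays within distance 1 of some term
  \<open>s N\<close>. The limit of the distances is then at most 1, so \<open>s\<close> and the
  constant \<open>s N\<close> differ by an element of \<open>Zp p\<close>.\<close>

lemma carrier_QpZp: "carrier (QpZp p) = range rat_coset"
proof -
  interpret abelian_subgroup "Zp p" "Qp p"
    by (rule Zp_abelian_subgroup)
  show ?thesis
  proof
    show "range rat_coset \<subseteq> carrier (QpZp p)"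
      by (auto simp: QpZp_simps rat_coset_def a_rcosetsI a_subset)
    show "carrier (QpZp p) \<subseteq> range rat_coset"
    proof
      fix g
      assume "g \<in> carrier (QpZp p)"
      then obtain s where s: "s \<in> carrier Cauchy_ring" and g: "g = Zp p +>\<^bsub>Qp p\<^esub> cls s"
        by (auto simp: QpZp_simps A_RCOSETS_def' a_r_coset_def' Qp_simps(3))
      obtain N where N: "\<forall>m\<ge>N. \<forall>n\<ge>N. padic_abs p (s m - s n) < 1"
        using s unfolding Cauchy_ring_carrier_iff by (meson zero_less_one)
      have diff: "(\<lambda>n. s n - s N) \<in> carrier Cauchy_ring"
        using add_in_Cauchy_ring[OF s const_in_Cauchy_ring[of "- s N"]] by simp
      then obtain l where l: "lift_norm (\<lambda>n. s n - s N) l"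
        by (rule lift_norm_exists)
      have "l \<le> 1"
        by (rule LIMSEQ_le_const2[OF l]) (use N in \<open>auto intro!: exI[of _ N] less_imp_le\<close>)
      then have "cls s \<in> rat_coset (s N)"
        using s l diff by (simp add: mem_rat_coset_iff padic_norm_cls)
      then have "g = rat_coset (s N)"
        using a_repr_independence'[of "cls s" "cls (\<lambda>n. s N)"] by (simp add: rat_coset_def g)
      then show "g \<in> range rat_coset"
        by blast
    qed
  qed
qed

lemma mult_rat_coset: "rat_coset q \<otimes>\<^bsub>QpZp p\<^esub> rat_coset q' = rat_coset (q + q')"
proof -
  interpret abelian_subgroup "Zp p" "Qp p"
    by (rule Zp_abelian_subgroup)
  show ?thesis
    by (simp add: QpZp_simps rat_coset_def a_rcos_sum Qp_add_cls)
qed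

lemma rat_coset_0: "rat_coset 0 = \<one>\<^bsub>QpZp p\<^esub>"
proof -
  interpret abelian_subgroup "Zp p" "Qp p"
    by (rule Zp_abelian_subgroup)
  show ?thesis
    using a_rcos_const[OF additive_subgroup.zero_closed[OF Zp_additive_subgroup]]
    by (simp add: QpZp_simps rat_coset_def cls_zero)
qed

text \<open>If \<open>q\<close> has absolute value above 1, adding \<open>z\<close> from
  \<open>Zp p\<close> keeps the norm: the sum \<open>x\<close> is no larger than \<open>q\<close>,
  and writing \<open>q\<close> as \<open>x\<close> minus \<open>z\<close> shows that
  \<open>q\<close> is no larger than \<open>x\<close>, because \<open>z\<close> is too small to be
  the maximum. Hence \<open>THE\<close> in \<open>QpZp_norm\<close> is determined.\<close>

lemma QpZp_norm_rat_coset: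
  "QpZp_norm p (rat_coset q) = (if padic_abs p q \<le> 1 then 0 else padic_abs p q)"
proof -
  interpret abelian_subgroup "Zp p" "Qp p"
    by (rule Zp_abelian_subgroup)
  have self: "cls (\<lambda>n. q) \<in> rat_coset q"
    by (simp add: mem_rat_coset_iff)
  show ?thesis
  proof (cases "padic_abs p q \<le> 1")
    case True
    then show ?thesis
      using rat_coset_eqI[of q 0] by (simp add: QpZp_norm_def rat_coset_0)
  next
    case False
    have "rat_coset q \<noteq> \<one>\<^bsub>QpZp p\<^esub>"
      using self False unfolding QpZp_simps Zp_def by auto
    moreover have "(THE l. \<forall>x\<in>rat_coset q. padic_norm p x = l) = padic_abs p q"
    proof (rule the_equality)
      show "\<forall>x\<in>rat_coset q. padic_norm p x = padic_abs p q"
      proof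
        fix x
        assume "x \<in> rat_coset q"
        then obtain z where z: "z \<in> carrier (Qp p)" "padic_norm p z \<le> 1"
          and x: "x = z \<oplus>\<^bsub>Qp p\<^esub> cls (\<lambda>n. q)"
          unfolding rat_coset_def a_r_coset_def' Zp_def by blast
        have xc: "x \<in> carrier (Qp p)"
          using x z by simp
        have "padic_norm p x \<le> padic_abs p q"
          using padic_norm_add[of z "cls (\<lambda>n. q)"] z x False by simp
        moreover have "cls (\<lambda>n. q) = \<ominus>\<^bsub>Qp p\<^esub> z \<oplus>\<^bsub>Qp p\<^esub> x"
          using z x by (simp add: r_neg1)
        then have "padic_abs p q \<le> max (padic_norm p z) (padic_norm p x)"
          using padic_norm_add[of "\<ominus>\<^bsub>Qp p\<^esub> z" x] z xc
          by (metis add.inv_closed padic_norm_const padic_norm_uminus)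
        ultimately show "padic_norm p x = padic_abs p q"
          using z False by auto
      qed
      then show "l = padic_abs p q" if "\<forall>x\<in>rat_coset q. padic_norm p x = l" for l
        using self that by force
    qed
    ultimately show ?thesis
      using False by (simp add: QpZp_norm_def)
  qed
qed

section \<open>Countability, ultrametric inequality and spheres of the quotient\<close>

lemma countable_carrier_QpZp: "countable (carrier (QpZp p))"
  by (simp add: carrier_QpZp)

lemma QpZp_norm_nonneg: "g \<in> carrier (QpZp p) \<Longrightarrow> QpZp_norm p g \<ge> 0"
  by (auto simp: carrier_QpZp QpZp_norm_rat_coset)

lemma QpZp_norm_mult:
  assumes "g \<in> carrier (QpZp p)" "h \<in> carrier (QpZp p)"
  shows "QpZp_norm p (g \<otimes>\<^bsub>QpZp p\<^esub> h) \<le> max (QpZp_norm p g) (QpZp_norm p h)"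
proof -
  obtain q q' where "g = rat_coset q" "h = rat_coset q'"
    using assms by (auto simp: carrier_QpZp)
  then show ?thesis
    using padic_abs_add[of q q'] by (auto simp: mult_rat_coset QpZp_norm_rat_coset)
qed

text \<open>The nonzero absolute values of rationals are powers of \<open>p\<close>, and those up to
  1 collapse to 0 in the quotient.\<close>

lemma QpZp_norm_cases:
  assumes "g \<in> carrier (QpZp p)"
  obtains "QpZp_norm p g = 0" | i where "i \<ge> 1" "QpZp_norm p g = real p ^ i"
proof -
  obtain q where "g = rat_coset q"
    using assms by (auto simp: carrier_QpZp)
  then have norm: "QpZp_norm p g = (if padic_abs p q \<le> 1 then 0 else padic_abs p q)"
    by (simp add: QpZp_norm_rat_coset)
  show ?thesis
  proof (cases "padic_abs p q \<le> 1")
    case True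
    with norm that(1) show ?thesis
      by simp
  next
    case False
    then have "padic_abs p q > 1"
      by simp
    then obtain i where "i \<ge> 1" "padic_abs p q = real p ^ i"
      by (rule padic_abs_gt_1E)
    with False norm that(2) show ?thesis
      by simp
  qed
qed

text \<open>Principal parts represent every point of the sphere by a fraction
  \<open>a / p ^ i\<close> with \<open>a < p ^ i\<close>. The exact count is
  \<open>p ^ i - p ^ (i - 1)\<close>; the coarser bound only affects the constant.\<close>

lemma QpZp_sphere:
  assumes "i \<ge> 1"
  shows "finite {g \<in> carrier (QpZp p). QpZp_norm p g = real p ^ i}"
    and "card {g \<in> carrier (QpZp p). QpZp_norm p g = real p ^ i} \<le> p ^ i"
proof -
  have sub: "{g \<in> carrier (QpZp p). QpZp_norm p g = real p ^ i}
      \<subseteq> (\<lambda>a. rat_coset (of_nat a / of_nat p ^ i)) ` {..<p ^ i}"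
  proof clarify
    fix g
    assume "g \<in> carrier (QpZp p)" and norm: "QpZp_norm p g = real p ^ i"
    then obtain q where q: "g = rat_coset q"
      by (auto simp: carrier_QpZp)
    have "padic_abs p q \<le> real p ^ i"
      using norm p_gt_1 one_le_power[of "real p" i] by (auto simp: q QpZp_norm_rat_coset split: if_splits)
    then obtain a where "a < p ^ i" "padic_abs p (q - of_nat a / of_nat p ^ i) \<le> 1"
      by (rule padic_principal_part)
    then show "g \<in> (\<lambda>a. rat_coset (of_nat a / of_nat p ^ i)) ` {..<p ^ i}"
      using rat_coset_eqI q by blast
  qed
  then show "finite {g \<in> carrier (QpZp p). QpZp_norm p g = real p ^ i}"
    by (rule finite_subset) simp
  show "card {g \<in> carrier (QpZp p). QpZp_norm p g = real p ^ i} \<le> p ^ i"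
    using surj_card_le[OF _ sub] by simp
qed

end

section \<open>Moments of the random walk\<close>

text \<open>Summing over the level sets beyond \<open>T\<close> bounds the moment by a geometric
  series of ratio \<open>q powr (r - b)\<close>, which is below 1. Its first term is of order
  \<open>T powr (r - b)\<close>.\<close>

lemma (in prob_space) tail_moment_geometric_values:
  fixes Y :: "'a \<Rightarrow> real" and q b c r T :: real
  assumes Y: "random_variable borel Y"
    and q: "q > 1" and c: "c \<ge> 0" and r: "r < b" and T: "T > 0"
    and vals: "\<And>\<omega>. \<omega> \<in> space M \<Longrightarrow> Y \<omega> = 0 \<or> (\<exists>i\<ge>1. Y \<omega> = q ^ i)"
    and law: "\<And>i::nat. i \<ge> 1 \<Longrightarrow> prob {\<omega> \<in> space M. Y \<omega> = q ^ i} \<le> c * q powr - (real i * b)"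
  defines "f \<equiv> \<lambda>\<omega>. Y \<omega> powr r * indicator {T<..} (Y \<omega>)"
  shows "integrable M f"
    and "expectation f \<le> c / (1 - q powr (r - b)) * T powr (r - b)"
proof -
  \<comment> \<open>The event \<open>Y = q ^ i\<close> contributes at most
    \<open>(q ^ i) powr r\<close> times \<open>c * q powr - (real i * b)\<close>, that is
    \<open>c * x ^ i\<close>. Since \<open>law\<close> starts at index 1, \<open>a\<close> vanishes
    at 0; \<open>d\<close> is only an upper bound and may be positive there.\<close>
  define x where "x = q powr (r - b)"
  define d where "d i = (if q ^ i > T then c * x ^ i else 0)" for i
  define A where "A i = {\<omega> \<in> space M. Y \<omega> = q ^ i}" for i
  define a where "a i = (if i \<ge> 1 \<and> q ^ i > T then (q ^ i) powr r else 0)" for i :: nat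
  have x: "0 < x" "x < 1"
    using q r by (simp_all add: x_def powr_less_one)
  have xpow: "x ^ i = (q ^ i) powr (r - b)" for i
    using q by (simp add: x_def powr_powr powr_realpow[symmetric] mult.commute)
  have d_nonneg: "d i \<ge> 0" for i
    using c x by (simp add: d_def)
  have geom: "summable (\<lambda>i. c * x ^ i)"
    using x by (intro summable_mult summable_geometric) simp
  have d_summable: "summable d"
    using c x by (intro summable_comparison_test'[OF geom, of 0]) (simp add: d_def)
  obtain m0 where "q ^ m0 > T"
    using real_arch_pow[OF q] by blast
  \<comment> \<open>The truncated series starts at the least exponent beyond the threshold, so its
    sum carries the factor \<open>x ^ m\<close>.\<close>
  define m where "m = (LEAST m. q ^ m > T)"
  have m: "q ^ m > T"
    unfolding m_def by (rule LeastI) fact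
  have d_small: "d i = 0" if "i < m" for i
    using that not_less_Least unfolding m_def d_def by auto
  have "suminf d = (\<Sum>i. d (i + m))"
    using suminf_split_initial_segment[OF d_summable, of m] d_small by simp
  also have "\<dots> \<le> (\<Sum>i. (c * x ^ m) * x ^ i)"
  proof (rule suminf_le)
    show "d (i + m) \<le> (c * x ^ m) * x ^ i" for i
      using c x by (simp add: d_def power_add mult_ac)
    show "summable (\<lambda>i. d (i + m))"
      using d_summable by (rule summable_ignore_initial_segment)
    show "summable (\<lambda>i. (c * x ^ m) * x ^ i)"
      using x by (intro summable_mult summable_geometric) simp
  qed
  also have "\<dots> = c / (1 - x) * x ^ m"
    using x suminf_geometric[of x] by (simp add: suminf_mult summable_geometric)
  \<comment> \<open>Here \<open>x ^ m\<close> is \<open>(q ^ m) powr (r - b)\<close>, where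
    \<open>q ^ m > T\<close> and the exponent is negative.\<close>
  also have "\<dots> \<le> c / (1 - x) * T powr (r - b)"
    using c x m T r unfolding xpow by (intro mult_left_mono powr_mono2') auto
  finally have d_sum: "suminf d \<le> c / (1 - x) * T powr (r - b)" .
  have A: "A i \<in> sets M" for i
    using Y unfolding A_def by measurable
  have a_law: "ennreal (a i) * emeasure M (A i) \<le> ennreal (d i)" for i
  proof (cases "i \<ge> 1 \<and> q ^ i > T")
    case True
    have "a i * prob (A i) \<le> (q ^ i) powr r * (c * q powr - (real i * b))"
      using True law[of i] by (auto simp: a_def A_def intro!: mult_left_mono)
    also have "\<dots> = c * ((q powr i) powr r * q powr - (real i * b))"
      using q by (simp add: powr_realpow)
    also have "\<dots> = c * x ^ i"
      using q by (simp add: x_def powr_powr powr_add[symmetric] powr_realpow[symmetric] algebra_simps)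
    finally show ?thesis
      using True by (simp add: emeasure_eq_measure d_def a_def ennreal_leI flip: ennreal_mult)
  qed (auto simp: a_def)
  have f_nonneg: "f \<omega> \<ge> 0" for \<omega>
    by (simp add: f_def)
  have f_meas: "f \<in> borel_measurable M"
    using Y unfolding f_def by measurable
  have ennreal_le_suminf: "g i \<le> suminf g" for g :: "nat \<Rightarrow> ennreal" and i
    using sum_le_suminf[of g "{i}"] by simp
  \<comment> \<open>Above the threshold \<open>f\<close> equals the term indexed by the exponent of
    \<open>Y\<close>, and the whole series dominates that term.\<close>
  have pointwise: "ennreal (f \<omega>) \<le> (\<Sum>i. ennreal (a i) * indicator (A i) \<omega>)" if \<omega>: "\<omega> \<in> space M" for \<omega>
  proof (cases "Y \<omega> > T")
    case True
    then obtain i where i: "i \<ge> 1" "Y \<omega> = q ^ i"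
      using vals[OF \<omega>] T by auto
    have "ennreal (f \<omega>) = ennreal (a i) * indicator (A i) \<omega>"
      using i True \<omega> by (simp add: f_def a_def A_def)
    also have "\<dots> \<le> (\<Sum>i. ennreal (a i) * indicator (A i) \<omega>)"
      using ennreal_le_suminf .
    finally show ?thesis .
  qed (simp add: f_def)
  \<comment> \<open>Extended nonnegative integrals can be summed termwise before integrability is
    known; the finite bound then yields it.\<close>
  have "(\<integral>\<^sup>+\<omega>. ennreal (f \<omega>) \<partial>M) \<le> (\<integral>\<^sup>+\<omega>. (\<Sum>i. ennreal (a i) * indicator (A i) \<omega>) \<partial>M)"
    using pointwise by (rule nn_integral_mono)
  also have "\<dots> = (\<Sum>i. ennreal (a i) * emeasure M (A i))"
    using A by (simp add: nn_integral_suminf nn_integral_cmult_indicator)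
  also have "\<dots> \<le> (\<Sum>i. ennreal (d i))"
    by (intro suminf_le a_law) auto
  also have "\<dots> = ennreal (suminf d)"
    using d_nonneg d_summable by (rule suminf_ennreal2)
  finally have nn: "(\<integral>\<^sup>+\<omega>. ennreal (f \<omega>) \<partial>M) \<le> ennreal (suminf d)" .
  then show int: "integrable M f"
    using f_meas f_nonneg by (intro integrableI_nonneg) (auto intro: order_le_less_trans)
  have "ennreal (expectation f) \<le> ennreal (suminf d)"
    using nn nn_integral_eq_integral[OF int] f_nonneg by simp
  then have "expectation f \<le> suminf d"
    using suminf_nonneg[OF d_summable d_nonneg] by (simp add: ennreal_le_iff)
  with d_sum show "expectation f \<le> c / (1 - q powr (r - b)) * T powr (r - b)"
    by (simp add: x_def)
qed

section \<open>Law of the step norm, and the walk under the ultrametric inequality\<close>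

context padic_prime
begin

lemma QpZp_norm_measurable:
  assumes "Y \<in> measurable M (count_space (carrier (QpZp p)))"
  shows "(\<lambda>\<omega>. QpZp_norm p (Y \<omega>)) \<in> borel_measurable M"
  using assms by (rule measurable_compose) simp

text \<open>The event splits over the sphere, which has at most \<open>p ^ i\<close> points of equal
  mass. As \<open>p\<close> is at least 2, the denominator \<open>p ^ i - p ^ (i - 1)\<close> is at
  least half of \<open>p ^ i\<close>, whence the factor 2.\<close>

lemma step_law_norm_le:
  assumes "prob_space M" and law: "has_step_law p b M Y" and "b > 0" "i \<ge> 1"
  shows "measure M {\<omega> \<in> space M. QpZp_norm p (Y \<omega>) = real p ^ i} \<le>
    2 * (real p powr b - 1) * real p powr - (real i * b)"
proof -
  interpret prob_space M by fact
  let ?S = "{g \<in> carrier (QpZp p). QpZp_norm p g = real p ^ i}"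
  let ?w = "(real p powr b - 1) / real p powr (real i * b) * (1 / (real p ^ i - real p ^ (i - 1)))"
  have Y: "Y \<in> measurable M (count_space (carrier (QpZp p)))"
    using law by (simp add: has_step_law_def)
  have pb: "real p powr b \<ge> 1"
    using p_gt_1 \<open>b > 0\<close> by (simp add: ge_one_powr_ge_zero)
  have "real p \<ge> 2"
    using prime_ge_2_nat[OF prime_p] by simp
  moreover have pw: "real p ^ i = real p * real p ^ (i - 1)"
    using \<open>i \<ge> 1\<close> by (simp flip: power_Suc)
  ultimately have diff: "real p ^ i - real p ^ (i - 1) \<ge> real p ^ i / 2"
    using p_gt_1 by (simp add: mult_right_mono)
  have pos: "real p ^ i > 0"
    using p_gt_1 by simp
  have "{\<omega> \<in> space M. QpZp_norm p (Y \<omega>) = real p ^ i} = (\<Union>g\<in>?S. {\<omega> \<in> space M. Y \<omega> = g})"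
    using measurable_space[OF Y] by auto
  also have "prob \<dots> \<le> (\<Sum>g\<in>?S. prob {\<omega> \<in> space M. Y \<omega> = g})"
  proof (rule finite_measure_subadditive_finite[OF QpZp_sphere(1)[OF \<open>i \<ge> 1\<close>]])
    have "{\<omega> \<in> space M. Y \<omega> = g} \<in> events" if "g \<in> carrier (QpZp p)" for g
    proof -
      have "Y -` {g} \<inter> space M \<in> events"
        using that by (intro measurable_sets[OF Y]) auto
      also have "Y -` {g} \<inter> space M = {\<omega> \<in> space M. Y \<omega> = g}"
        by auto
      finally show ?thesis .
    qed
    then show "(\<lambda>g. {\<omega> \<in> space M. Y \<omega> = g}) ` ?S \<subseteq> events"
      by blast
  qed
  also have "\<dots> = (\<Sum>g\<in>?S. ?w)"
    using law \<open>i \<ge> 1\<close> by (intro sum.cong) (auto simp: has_step_law_def)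
  also have "\<dots> = real (card ?S) * ?w"
    by simp
  also have "\<dots> \<le> real p ^ i * ((real p powr b - 1) / real p powr (real i * b) * (1 / (real p ^ i / 2)))"
  proof (rule mult_mono)
    show "real (card ?S) \<le> real p ^ i"
      using QpZp_sphere(2)[OF \<open>i \<ge> 1\<close>] by (simp flip: of_nat_power)
    have "1 / (real p ^ i - real p ^ (i - 1)) \<le> 1 / (real p ^ i / 2)"
      using diff pos by (intro divide_left_mono mult_pos_pos) linarith+
    then show "?w \<le> (real p powr b - 1) / real p powr (real i * b) * (1 / (real p ^ i / 2))"
      using pb by (intro mult_left_mono) auto
    have "1 / (real p ^ i - real p ^ (i - 1)) \<ge> 0"
      using diff pos by (intro divide_nonneg_nonneg) linarith+
    then show "?w \<ge> 0"
      using pb by (intro mult_nonneg_nonneg) auto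
  qed (use pos in simp)
  also have "\<dots> = 2 * (real p powr b - 1) * real p powr - (real i * b)"
  proof -
    have cancel: "P * (u / v * (1 / (P / 2))) = 2 * u * inverse v" if "P > 0" for P u v :: real
      using that by (cases "v = 0") (simp_all add: field_simps)
    show ?thesis
      unfolding powr_minus by (rule cancel[OF pos])
  qed
  finally show ?thesis .
qed

text \<open>Splitting over the countably many values \<open>g\<close> of the previous position
  leaves translates of a step by a fixed \<open>g\<close>, which are measurable into the discrete
  space.\<close>

lemma random_walk_measurable:
  assumes "\<And>k. k \<ge> 1 \<Longrightarrow> X k \<in> measurable M (count_space (carrier (QpZp p)))"
  shows "random_walk p X n \<in> measurable M (count_space (carrier (QpZp p)))"
proof -
  interpret comm_group "QpZp p"
    by (rule comm_group_QpZp)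
  show ?thesis
  proof (induction n)
    case 0
    then show ?case
      by simp
  next
    case (Suc n)
    have "(\<lambda>\<omega>. random_walk p X n \<omega> \<otimes>\<^bsub>QpZp p\<^esub> X (Suc n) \<omega>)
        \<in> measurable M (count_space (carrier (QpZp p)))"
    proof (rule measurable_compose_countable'[OF _ Suc.IH countable_carrier_QpZp])
      fix g
      assume "g \<in> carrier (QpZp p)"
      then show "(\<lambda>\<omega>. g \<otimes>\<^bsub>QpZp p\<^esub> X (Suc n) \<omega>) \<in> measurable M (count_space (carrier (QpZp p)))"
        by (intro measurable_compose[OF assms]) auto
    qed
    then show ?case
      by simp
  qed
qed

text \<open>By the ultrametric inequality the position never exceeds the largest step. The
  alternative with \<open>T\<close> covers the empty walk, which has norm 0 and no step to compare
  with.\<close>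

lemma random_walk_norm_le:
  assumes X: "\<And>k. k \<ge> 1 \<Longrightarrow> X k \<omega> \<in> carrier (QpZp p)"
    and "T \<ge> 0"
  shows "QpZp_norm p (random_walk p X n \<omega>) \<le> T \<or>
    (\<exists>k\<in>{1..n}. QpZp_norm p (random_walk p X n \<omega>) \<le> QpZp_norm p (X k \<omega>))"
proof (induction n)
  case 0
  then show ?case
    using \<open>T \<ge> 0\<close> by (simp add: QpZp_norm_def)
next
  case (Suc n)
  interpret comm_group "QpZp p"
    by (rule comm_group_QpZp)
  have "random_walk p X n \<omega> \<in> carrier (QpZp p)"
    by (induction n) (simp_all add: X)
  then have "QpZp_norm p (random_walk p X (Suc n) \<omega>) \<le>
      max (QpZp_norm p (random_walk p X n \<omega>)) (QpZp_norm p (X (Suc n) \<omega>))"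
    using QpZp_norm_mult X by simp
  then consider "QpZp_norm p (random_walk p X (Suc n) \<omega>) \<le> QpZp_norm p (X (Suc n) \<omega>)"
    | "QpZp_norm p (random_walk p X (Suc n) \<omega>) \<le> QpZp_norm p (random_walk p X n \<omega>)"
    by (auto simp: le_max_iff_disj)
  then show ?case
  proof cases
    case 1
    then show ?thesis
      by (intro disjI2 bexI[of _ "Suc n"]) auto
  next
    case 2
    from Suc.IH show ?thesis
    proof
      assume "QpZp_norm p (random_walk p X n \<omega>) \<le> T"
      with 2 show ?thesis
        by linarith
    next
      assume "\<exists>k\<in>{1..n}. QpZp_norm p (random_walk p X n \<omega>) \<le> QpZp_norm p (X k \<omega>)"
      then obtain k where k: "k \<in> {1..n}"
        "QpZp_norm p (random_walk p X n \<omega>) \<le> QpZp_norm p (X k \<omega>)"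
        by blast
      then show ?thesis
        using 2 by (intro disjI2 bexI[of _ k]) auto
    qed
  qed
qed

end

section \<open>The moment bound with a balanced threshold\<close>

text \<open>Integrability is part of the claim because the Bochner integral of a non-integrable
  function is 0 by convention, which would make the bound empty. \<open>K\<close> is chosen after
  \<open>r\<close>: already for \<open>n = 1\<close> the moment grows without bound as
  \<open>r\<close> approaches \<open>b\<close>, so no single constant serves all
  \<open>r\<close>.\<close>

theorem theorem3p1:
  fixes p :: nat and b :: real
    and M :: "'w measure" and X :: "nat \<Rightarrow> 'w \<Rightarrow> padic set"
  assumes "prime p" and "0 < b"
    and "prob_space M"
    and "prob_space.indep_vars M (\<lambda>_. count_space (carrier (QpZp p))) X {1..}"
    and "\<And>k. k \<ge> 1 \<Longrightarrow> has_step_law p b M (X k)"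
  shows "\<forall>r\<in>{0<..<b}. \<exists>K::real. \<forall>n::nat. n \<ge> 1 \<longrightarrow>
           integrable M (\<lambda>\<omega>. QpZp_norm p (random_walk p X n \<omega>) powr r) \<and>
           prob_space.expectation M (\<lambda>\<omega>. QpZp_norm p (random_walk p X n \<omega>) powr r)
             < K * real n powr (r / b)"
proof
  fix r
  assume "r \<in> {0<..<b}"
  then have r: "0 < r" "r < b"
    by auto
  interpret padic_prime p
    by standard fact
  interpret prob_space M
    by fact
  \<comment> \<open>\<open>c\<close> comes from the law of the step norm and \<open>C\<close> from
    the tail moment; \<open>C\<close> tends to infinity as \<open>r\<close> approaches
    \<open>b\<close>.\<close>
  define c where "c = 2 * (real p powr b - 1)"
  define C where "C = c / (1 - real p powr (r - b))"
  have c: "c \<ge> 0"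
    using p_gt_1 \<open>0 < b\<close> by (simp add: c_def ge_one_powr_ge_zero)
  have X: "X k \<in> measurable M (count_space (carrier (QpZp p)))" if "k \<ge> 1" for k
    using assms(5)[OF that] by (simp add: has_step_law_def)
  have carr: "X k \<omega> \<in> carrier (QpZp p)" if "k \<ge> 1" "\<omega> \<in> space M" for k \<omega>
    using measurable_space[OF X] that by simp
  \<comment> \<open>The part of the moment of step \<open>k\<close> that stems from norms above
    \<open>T\<close>.\<close>
  define Z where "Z T k \<omega> = QpZp_norm p (X k \<omega>) powr r * indicator {T<..} (QpZp_norm p (X k \<omega>))"
    for T k \<omega>
  have Z: "integrable M (Z T k)" "expectation (Z T k) \<le> C * T powr (r - b)"
    if "T > 0" "k \<ge> 1" for T k
  proof -
    have vals: "QpZp_norm p (X k \<omega>) = 0 \<or> (\<exists>i\<ge>1. QpZp_norm p (X k \<omega>) = real p ^ i)"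
      if "\<omega> \<in> space M" for \<omega>
      using QpZp_norm_cases[OF carr[OF \<open>k \<ge> 1\<close> that]] by blast
    have law: "prob {\<omega> \<in> space M. QpZp_norm p (X k \<omega>) = real p ^ i} \<le> c * real p powr - (real i * b)"
      if "i \<ge> 1" for i
      using step_law_norm_le[OF \<open>prob_space M\<close> assms(5)[OF \<open>k \<ge> 1\<close>] \<open>0 < b\<close> that]
      by (simp add: c_def)
    note tail = tail_moment_geometric_values[OF QpZp_norm_measurable[OF X[OF \<open>k \<ge> 1\<close>]]
        p_gt_1 c \<open>r < b\<close> \<open>T > 0\<close>]
    show "integrable M (Z T k)" "expectation (Z T k) \<le> C * T powr (r - b)"
      unfolding Z_def C_def using vals law by (intro tail; simp)+
  qed
  show "\<exists>K::real. \<forall>n::nat. n \<ge> 1 \<longrightarrow>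
      integrable M (\<lambda>\<omega>. QpZp_norm p (random_walk p X n \<omega>) powr r) \<and>
      expectation (\<lambda>\<omega>. QpZp_norm p (random_walk p X n \<omega>) powr r) < K * real n powr (r / b)"
  \<comment> \<open>One unit of \<open>2 + C\<close> pays for \<open>T powr r\<close>, and
    \<open>C\<close> for the \<open>n\<close> tail moments. The spare unit makes the inequality
    strict, as \<open>n \<ge> 1\<close> gives \<open>real n powr (r / b) > 0\<close>.\<close>
  proof (intro exI[of _ "2 + C"] allI impI)
    fix n :: nat
    assume n: "n \<ge> 1"
    \<comment> \<open>With this threshold both \<open>T powr r\<close> and
      \<open>real n * T powr (r - b)\<close> equal \<open>real n powr (r / b)\<close>.\<close>
    define T where "T = real n powr (1 / b)"
    have T: "T > 0"
      using n by (simp add: T_def)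
    let ?S = "\<lambda>\<omega>. QpZp_norm p (random_walk p X n \<omega>)"
    let ?B = "\<lambda>\<omega>. T powr r + (\<Sum>k=1..n. Z T k \<omega>)"
    have Z_nonneg: "Z T k \<omega> \<ge> 0" for k \<omega>
      by (simp add: Z_def)
    have le: "?S \<omega> powr r \<le> ?B \<omega>" if \<omega>: "\<omega> \<in> space M" for \<omega>
    proof -
      have S: "?S \<omega> \<ge> 0"
        using measurable_space[OF random_walk_measurable[OF X] \<omega>] by (simp add: QpZp_norm_nonneg)
      show ?thesis
      proof (cases "?S \<omega> \<le> T")
        case True
        then have "?S \<omega> powr r \<le> T powr r"
          using S r by (intro powr_mono2) auto
        then show ?thesis
          using sum_nonneg[of "{1..n}" "\<lambda>k. Z T k \<omega>"] Z_nonneg by (simp add: add_increasing2)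
      next
        case False
        then obtain k where k: "k \<in> {1..n}" "?S \<omega> \<le> QpZp_norm p (X k \<omega>)"
          using random_walk_norm_le[of X \<omega> T n, OF carr] \<omega> T by auto
        have "?S \<omega> powr r \<le> QpZp_norm p (X k \<omega>) powr r"
          using k S r by (intro powr_mono2) auto
        \<comment> \<open>Step \<open>k\<close> is at least as large as the position, hence above
          \<open>T\<close>, so the indicator is 1.\<close>
        also have "\<dots> = Z T k \<omega>"
          using False k by (simp add: Z_def)
        also have "\<dots> \<le> (\<Sum>k=1..n. Z T k \<omega>)"
          using k Z_nonneg by (intro member_le_sum) auto
        finally show ?thesis
          by (simp add: add_increasing)
      qed
    qed
    have int_sum: "integrable M (\<lambda>\<omega>. \<Sum>k=1..n. Z T k \<omega>)"
      using Z(1)[OF T] by (intro Bochner_Integration.integrable_sum) simp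
    then have intB: "integrable M ?B"
      by simp
    have meas: "(\<lambda>\<omega>. ?S \<omega> powr r) \<in> borel_measurable M"
      using QpZp_norm_measurable[OF random_walk_measurable[OF X]] by measurable
    have int: "integrable M (\<lambda>\<omega>. ?S \<omega> powr r)"
    proof (rule Bochner_Integration.integrable_bound[OF intB meas], rule AE_I2)
      fix \<omega>
      assume "\<omega> \<in> space M"
      from le[OF this] show "norm (?S \<omega> powr r) \<le> norm (?B \<omega>)"
        by simp
    qed
    have "expectation (\<lambda>\<omega>. ?S \<omega> powr r) \<le> expectation ?B"
      using int intB le by (rule integral_mono)
    also have "\<dots> = T powr r + (\<Sum>k=1..n. expectation (Z T k))"
      using int_sum Z(1)[OF T] by (simp add: prob_space)
    also have "\<dots> \<le> T powr r + (\<Sum>k=1..n. C * T powr (r - b))"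
      using Z(2)[OF T] by (intro add_left_mono sum_mono) simp
    also have "\<dots> = T powr r + C * (real n * T powr (r - b))"
      by simp
    also have "real n * T powr (r - b) = real n powr (1 + (r - b) / b)"
      using n by (simp add: T_def powr_powr powr_add)
    also have "1 + (r - b) / b = r / b"
      using \<open>0 < b\<close> by (simp add: field_simps)
    also have "T powr r = real n powr (r / b)"
      by (simp add: T_def powr_powr)
    finally have "expectation (\<lambda>\<omega>. ?S \<omega> powr r) \<le> (1 + C) * real n powr (r / b)"
      by (simp add: algebra_simps)
    also have "\<dots> < (2 + C) * real n powr (r / b)"
      using n by (intro mult_strict_right_mono) auto
    finally show "integrable M (\<lambda>\<omega>. ?S \<omega> powr r) \<and>
        expectation (\<lambda>\<omega>. ?S \<omega> powr r) < (2 + C) * real n powr (r / b)"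
      using int by blast
  qed
qed

end
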